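(* Let $k>1$ be an integer and let $\mathcal{F}$ be a foliation of degree $d$ on $\mathbb{P}^2_k=\mathbb{P}(1,1,k)$. Suppose $\mathcal{F}$ has only isolated singularities. If $k\nmid d^2$, then $\mathcal{F}$ has a singularity at $\mathrm{Sing}(\mathbb{P}^2_k)=\{\mathsf{e}_2\}$, where $\mathsf{e}_2=[0:0:1]_k$.
   Context: $\mathbb{P}^2_k=\mathbb{P}(1,1,k)=(\mathbb{C}^{3}\setminus\{0\})/\mathbb{C}^\ast$ with action $\lambda\cdot(z_0,z_1,z_2)=(\lambda z_0,\lambda z_1,\lambda^{k}z_2)$. It is a compact complex orbifold of dimension $2$ whose only singular point is $\mathsf{e}_2=[0:0:1]_k$: the open set $\{z_2\neq0\}$ is $\mathbb{C}^2/\mu_k$, where $\mathbb{C}^2$ is identified with $\{z_2=1\}$ and $\zeta\in\mu_k$ (the $k$-th roots of unity) acts by $(z_0,z_1)\mapsto(\zeta z_0,\zeta z_1)$. The local smoothing covering at $\mathsf{e}_2$ is the quotient map $(\mathbb{C}^2,0)\to(\mathbb{C}^2/\mu_k,\mathsf{e}_2)$; at other points the local group is trivial. $\mathscr{O}_{\mathbb{P}^2_k}(m)$, $m\in\mathbb{Z}$, is the orbifold line bundle whose sections are the functions on ($\mathbb{C}^\ast$-invariant open subsets of) $\mathbb{C}^{3}\setminus\{0\}$ with $f(\lambda\cdot z)=\lambda^m f(z)$; $T\mathbb{P}^2_k$ is the orbifold tangent bundle (tangent bundles of the local coverings). A holomorphic foliation $\mathcal{F}$ of degree $d\in\mathbb{Z}$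 on $\mathbb{P}^2_k$ is one induced by a holomorphic section $\xi$ of $T\mathbb{P}^2_k\otimes\mathscr{O}_{\mathbb{P}^2_k}(d-1)$. On local smoothing coverings $\pi_p:(\widetilde U,\tilde p)\to(U,p)$, $\xi$ lifts to a holomorphic section $\tilde\xi=\pi_p^\ast\xi$, invariant under the local group, of $T\widetilde U$ tensored with the lifted line bundle; trivializing the latter, $\tilde\xi$ is a holomorphic vector field near $\tilde p$. The foliation $\mathcal{F}$ has a singularity at $p$ iff $\tilde\xi(\tilde p)=0$ (in particular $\mathcal{F}$ is non-singular at $\mathsf{e}_2$ iff the lifted vector field on $(\mathbb{C}^2,0)$ does not vanish at $0$). "Only isolated singularities" means $\xi$ has only isolated zeros. *)

theory Defs
  imports "HOL-Analysis.Analysis"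
begin

text \<open>
  The homogeneous coordinates \<open>z\<^sub>0, z\<^sub>1, z\<^sub>2\<close> of the weighted projective plane are the components
  \<open>z $ 1\<close>, \<open>z $ 2\<close>, \<open>z $ 3\<close> of \<open>z :: complex ^ 3\<close>; in particular the component of weight \<open>k\<close> has
  index 3.
\<close>

definition wt :: "nat \<Rightarrow> 3 \<Rightarrow> nat" where
  "wt k a = (if a = 3 then k else 1)"

definition wact :: "nat \<Rightarrow> complex \<Rightarrow> complex ^ 3 \<Rightarrow> complex ^ 3" where
  "wact k c z = (\<chi> a. c ^ wt k a * z $ a)"

definition worbit :: "nat \<Rightarrow> complex ^ 3 \<Rightarrow> (complex ^ 3) set" where
  "worbit k z = {wact k c z | c. c \<noteq> 0}"

definition wproj :: "nat \<Rightarrow> (complex ^ 3) set set" where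
  "wproj k = worbit k ` (UNIV - {0})"

definition e2 :: "nat \<Rightarrow> (complex ^ 3) set" where
  "e2 k = worbit k (vector [0, 0, 1])"

definition local_group :: "nat \<Rightarrow> complex ^ 3 \<Rightarrow> complex set" where
  "local_group k z = {c. c \<noteq> 0 \<and> wact k c z = z}"

definition Sing :: "nat \<Rightarrow> (complex ^ 3) set set" where
  "Sing k = {P \<in> wproj k. \<exists>z\<in>P. local_group k z \<noteq> {1}}"

text \<open>
  The local smoothing coverings: \<open>chart k i\<close> maps the slice \<open>{z\<^sub>i = 1}\<close>, a copy of \<open>complex ^ 2\<close>,
  onto the open set \<open>{z\<^sub>i \<noteq> 0}\<close>. It is bijective for \<open>i = 1, 2\<close>, and for \<open>i = 3\<close> it is the quotient
  by the \<open>k\<close>-th roots of unity, with the origin as the only point over \<open>e2 k\<close>.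
\<close>

definition slice :: "3 \<Rightarrow> complex ^ 2 \<Rightarrow> complex ^ 3" where
  "slice i p = (if i = 1 then vector [1, p $ 1, p $ 2]
                else if i = 2 then vector [p $ 1, 1, p $ 2]
                else vector [p $ 1, p $ 2, 1])"

definition chart :: "nat \<Rightarrow> 3 \<Rightarrow> complex ^ 2 \<Rightarrow> (complex ^ 3) set" where
  "chart k i p = worbit k (slice i p)"

definition cholomorphic_on :: "(complex ^ 'n \<Rightarrow> complex ^ 'm) \<Rightarrow> (complex ^ 'n) set \<Rightarrow> bool" where
  "cholomorphic_on f V \<longleftrightarrow>
     (\<forall>p\<in>V. \<exists>D. (f has_derivative D) (at p) \<and> Vector_Spaces.linear (*s) (*s) D)"

text \<open>
  A change of smoothing coverings from \<open>chart k i\<close> to \<open>chart k j\<close> is a map \<open>h\<close> with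
  \<open>chart k j \<circ> h = chart k i\<close> on \<open>V\<close>. It is recorded together with the function \<open>g\<close> that moves the
  one slice to the other along the orbits; \<open>g\<close> is automatically holomorphic. For \<open>i = j = 3\<close> these
  are, on connected \<open>V\<close>, the elements \<open>h p = \<zeta> *s p\<close>, \<open>g p = \<zeta>\<close> of the local group at \<open>e2 k\<close>.
\<close>

definition transition ::
  "nat \<Rightarrow> 3 \<Rightarrow> 3 \<Rightarrow> (complex ^ 2) set \<Rightarrow> (complex ^ 2 \<Rightarrow> complex ^ 2) \<Rightarrow> (complex ^ 2 \<Rightarrow> complex) \<Rightarrow> bool"
where
  "transition k i j V h g \<longleftrightarrow>
     open V \<and> cholomorphic_on h V \<and> continuous_on V g \<and>
     (\<forall>p\<in>V. g p \<noteq> 0 \<and> slice j (h p) = wact k (g p) (slice i p))"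

text \<open>
  A section \<open>f\<close> of \<open>O(m)\<close>, that is, a function with \<open>f (wact k c z) = c powi m * f z\<close>, is
  trivialized over \<open>chart k i\<close> by restricting it to the slice. The transition functions of \<open>O(m)\<close>
  for these trivializations are therefore \<open>g powi m\<close>:
\<close>

lemma homogeneous_transition:
  assumes "\<And>c z. c \<noteq> 0 \<Longrightarrow> z \<noteq> 0 \<Longrightarrow> f (wact k c z) = c powi m * f z"
    and "transition k i j V h g" "p \<in> V"
  shows "f (slice j (h p)) = g p powi m * f (slice i p)"
proof -
  have "slice i p $ i \<noteq> 0"
    using exhaust_3[of i] by (auto simp: slice_def)
  hence "slice i p \<noteq> 0" by auto
  thus ?thesis using assms by (auto simp: transition_def)
qed

text \<open>
  A holomorphic section of \<open>T \<otimes> O(m)\<close> is given by its lifts to the smoothing coverings, written as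
  holomorphic vector fields by means of the above trivializations of \<open>O(m)\<close>. Tangent vectors are
  transported by the differential of \<open>h\<close>, elements of \<open>O(m)\<close> by \<open>g powi m\<close>. The case \<open>i = j = 3\<close>
  is the invariance under the local group at \<open>e2 k\<close>, which acts on the lift of \<open>O(m)\<close> as well.
\<close>

definition tangent_section :: "nat \<Rightarrow> int \<Rightarrow> (3 \<Rightarrow> complex ^ 2 \<Rightarrow> complex ^ 2) \<Rightarrow> bool" where
  "tangent_section k m X \<longleftrightarrow>
     (\<forall>i. cholomorphic_on (X i) UNIV) \<and>
     (\<forall>i j V h g. transition k i j V h g \<longrightarrow>
        (\<forall>p\<in>V. X j (h p) = (g p powi m) *s frechet_derivative h (at p) (X i p)))"

definition foliation :: "nat \<Rightarrow> int \<Rightarrow> (3 \<Rightarrow> complex ^ 2 \<Rightarrow> complex ^ 2) \<Rightarrow> bool" where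
  "foliation k d X \<longleftrightarrow> tangent_section k (d - 1) X"

text \<open>
  For a section, vanishing does not depend on the choice of the point \<open>p\<close> over \<open>P\<close>, because any two
  such points are related by a transition.
\<close>

definition singular_at :: "nat \<Rightarrow> (3 \<Rightarrow> complex ^ 2 \<Rightarrow> complex ^ 2) \<Rightarrow> (complex ^ 3) set \<Rightarrow> bool" where
  "singular_at k X P \<longleftrightarrow> P \<in> wproj k \<and> (\<exists>i p. chart k i p = P \<and> X i p = 0)"

definition only_isolated_singularities :: "(3 \<Rightarrow> complex ^ 2 \<Rightarrow> complex ^ 2) \<Rightarrow> bool" where
  "only_isolated_singularities X \<longleftrightarrow> (\<forall>i. discrete {p. X i p = 0})"

end

theory Submission
  imports Defs
begin

text \<open>
  A root of unity \<open>\<zeta>\<close> of order \<open>k\<close> in the local group at \<open>e2 k\<close> acts on the fibre of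
  \<open>T \<otimes> O(d - 1)\<close> over the origin of the smoothing covering as the scalar
  \<open>\<zeta> * \<zeta> powi (d - 1) = \<zeta> powi d\<close>. The lifted vector field is invariant, so if it does not
  vanish at the origin, then \<open>\<zeta> powi d = 1\<close>, that is, \<open>k\<close> divides \<open>d\<close> and hence \<open>d\<^sup>2\<close>.
\<close>

lemma wact_1 [simp]: "wact k 1 z = z"
  by (simp add: wact_def vec_eq_iff)

lemma wact_wact: "wact k c (wact k c' z) = wact k (c * c') z"
  by (simp add: wact_def vec_eq_iff power_mult_distrib mult.assoc)

lemma wact_eq_0_iff: "c \<noteq> 0 \<Longrightarrow> wact k c z = 0 \<longleftrightarrow> z = 0"
  by (simp add: wact_def vec_eq_iff)

lemma self_in_worbit: "z \<in> worbit k z"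
  unfolding worbit_def by (force intro: exI[of _ 1])

lemma worbit_wact:
  assumes "c \<noteq> 0"
  shows "worbit k (wact k c z) = worbit k z"
proof (intro set_eqI iffI)
  fix w assume "w \<in> worbit k (wact k c z)"
  then obtain a where "a \<noteq> 0" "w = wact k (a * c) z"
    by (auto simp: worbit_def wact_wact)
  with assms show "w \<in> worbit k z"
    by (auto simp: worbit_def)
next
  fix w assume "w \<in> worbit k z"
  then obtain a where "a \<noteq> 0" "w = wact k a z"
    by (auto simp: worbit_def)
  hence "w = wact k (a / c) (wact k c z)" "a / c \<noteq> 0"
    using assms by (auto simp: wact_wact)
  thus "w \<in> worbit k (wact k c z)"
    by (auto simp: worbit_def)
qed

lemma mem_worbit_iff: "w \<in> worbit k z \<longleftrightarrow> worbit k w = worbit k z"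
proof
  assume "w \<in> worbit k z"
  thus "worbit k w = worbit k z"
    by (auto simp: worbit_def[of k z] worbit_wact)
qed (metis self_in_worbit)

text \<open>The first two coordinates have weight 1, so \<open>c\<close> scales them by
  \<open>c\<close> itself and a nonzero one forces \<open>c = 1\<close>.\<close>

lemma local_group_trivial:
  assumes "z $ 1 \<noteq> 0 \<or> z $ 2 \<noteq> 0"
  shows "local_group k z = {1}"
proof -
  have "c = 1" if "wact k c z = z" for c
  proof -
    have "c * z $ 1 = z $ 1" "c * z $ 2 = z $ 2"
      using arg_cong[OF that, of "\<lambda>w. w $ 1"] arg_cong[OF that, of "\<lambda>w. w $ 2"]
      by (simp_all add: wact_def wt_def)
    with assms show ?thesis by auto
  qed
  thus ?thesis by (auto simp: local_group_def)
qed

lemma worbit_axis: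
  assumes "k > 0" "z \<noteq> 0" "z $ 1 = 0" "z $ 2 = 0"
  shows "worbit k z = e2 k"
proof -
  have z3: "z $ 3 \<noteq> 0"
    using assms(2-) by (auto simp: vec_eq_iff forall_3)
  \<comment> \<open>A \<open>k\<close>-th root of \<open>z $ 3\<close>: the action of
    \<open>c\<close> on the point with coordinates 0, 0, 1 multiplies the last one by
    \<open>c ^ k\<close>.\<close>
  define c where "c = exp (Ln (z $ 3) / of_nat k)"
  have "c ^ k = z $ 3"
    using assms(1) z3 by (simp add: c_def exp_of_nat_mult [symmetric])
  hence "z = wact k c (vector [0, 0, 1])"
    using assms(3,4) by (simp add: wact_def wt_def vec_eq_iff forall_3)
  moreover have "c \<noteq> 0"
    by (simp add: c_def)
  ultimately show ?thesis
    by (simp add: e2_def worbit_wact)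
qed

lemma e2_in_wproj: "e2 k \<in> wproj k"
  by (auto simp: e2_def wproj_def vec_eq_iff forall_3)

text \<open>For \<open>k > 0\<close> a primitive \<open>k\<close>-th root of unity, hence a
  generator of the local group at \<open>e2 k\<close>.\<close>

definition zeta :: "nat \<Rightarrow> complex" where
  "zeta k = exp (2 * of_real pi * \<i> / of_nat k)"

lemma zeta_nonzero [simp]: "zeta k \<noteq> 0"
  by (simp add: zeta_def)

lemma zeta_powi_eq_1_iff:
  assumes "k > 0"
  shows "zeta k powi n = 1 \<longleftrightarrow> int k dvd n"
proof -
  have "zeta k powi n = exp (of_int n * (2 * of_real pi * \<i> / of_nat k))"
    unfolding zeta_def by (rule exp_power_int)
  \<comment> \<open>The exponent is purely imaginary, so only the condition on its imaginary part
    remains.\<close>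
  also have "\<dots> = 1 \<longleftrightarrow> (\<exists>m::int. real_of_int n * (2 * pi / real k) = of_int (2 * m) * pi)"
    by (simp add: exp_eq_1)
  also have "\<dots> \<longleftrightarrow> (\<exists>m::int. real_of_int n = real_of_int (int k * m))"
    using assms by (simp add: field_simps)
  also have "\<dots> \<longleftrightarrow> int k dvd n"
    unfolding of_int_eq_iff by (auto simp: dvd_def)
  finally show ?thesis .
qed

lemma zeta_power_k: "k > 0 \<Longrightarrow> zeta k ^ k = 1"
  using zeta_powi_eq_1_iff[of k "int k"] by simp

lemma zeta_neq_1: "k > 1 \<Longrightarrow> zeta k \<noteq> 1"
  using zeta_powi_eq_1_iff[of k 1] by auto

text \<open>Off the axis where the first two coordinates vanish the local groups are trivial. The
  axis without 0 is a single orbit, and \<open>zeta k\<close>, which differs from 1 as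
  \<open>k > 1\<close>, fixes a point of it.\<close>

lemma Sing_eq:
  assumes "k > 1"
  shows "Sing k = {e2 k}"
proof (intro equalityI subsetI)
  fix P assume "P \<in> Sing k"
  then obtain u z where u: "u \<noteq> 0" "P = worbit k u" and z: "z \<in> P" "local_group k z \<noteq> {1}"
    by (auto simp: Sing_def wproj_def)
  have "z \<noteq> 0"
    using z(1) u by (auto simp: worbit_def wact_eq_0_iff)
  moreover have "z $ 1 = 0" "z $ 2 = 0"
    using local_group_trivial z(2) by blast+
  ultimately have "worbit k z = e2 k"
    using assms by (intro worbit_axis) auto
  thus "P \<in> {e2 k}"
    using z(1) u(2) by (simp add: mem_worbit_iff)
next
  fix P assume "P \<in> {e2 k}"
  have "wact k (zeta k) (vector [0, 0, 1]) = vector [0, 0, 1]"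
    using assms by (simp add: wact_def wt_def vec_eq_iff forall_3 zeta_power_k)
  hence "zeta k \<in> local_group k (vector [0, 0, 1])"
    by (simp add: local_group_def)
  hence "local_group k (vector [0, 0, 1]) \<noteq> {1}"
    using zeta_neq_1[OF assms] by auto
  moreover have "vector [0, 0, 1] \<in> e2 k"
    by (simp add: e2_def self_in_worbit)
  ultimately show "P \<in> Sing k"
    using \<open>P \<in> {e2 k}\<close> e2_in_wproj by (auto simp: Sing_def)
qed

text \<open>Links complex scaling by \<open>*s\<close> to \<open>has_derivative\<close>, which
  refers to the real structure.\<close>

lemma bounded_linear_vector_scalar_mult: "bounded_linear (\<lambda>p :: complex ^ 'n. c *s p)"
  by (intro linear_conv_bounded_linear[THEN iffD1] linearI) (simp_all add: vec_eq_iff algebra_simps)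

text \<open>Since \<open>zeta k ^ k = 1\<close>, the action of \<open>zeta k\<close> keeps the last
  coordinate of the slice equal to 1 and scales the other two.\<close>

lemma transition_zeta:
  assumes "k > 0"
  shows "transition k 3 3 UNIV (\<lambda>p. zeta k *s p) (\<lambda>_. zeta k)"
proof -
  have "Vector_Spaces.linear (*s) (*s) (\<lambda>p :: complex ^ 2. zeta k *s p)"
    by (intro vec.linear_scale_self)
  hence "cholomorphic_on (\<lambda>p :: complex ^ 2. zeta k *s p) UNIV"
    unfolding cholomorphic_on_def
    using bounded_linear_imp_has_derivative[OF bounded_linear_vector_scalar_mult] by blast
  thus ?thesis
    using assms
    by (simp add: transition_def slice_def wact_def wt_def vec_eq_iff forall_3 zeta_power_k)
qed

text \<open>Of the exponent \<open>m + 1\<close>, the part \<open>m\<close> comes from the line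
  bundle and the 1 from the differential of the scaling, which is again multiplication by
  \<open>zeta k\<close>.\<close>

lemma tangent_section_zeta:
  assumes "k > 0" "tangent_section k m X"
  shows "X 3 (zeta k *s p) = zeta k powi (m + 1) *s X 3 p"
proof -
  have "frechet_derivative (\<lambda>p. zeta k *s p) (at p) = (\<lambda>p. zeta k *s p)"
    by (metis bounded_linear_imp_has_derivative bounded_linear_vector_scalar_mult
        frechet_derivative_at)
  moreover have "X 3 (zeta k *s p) =
      zeta k powi m *s frechet_derivative (\<lambda>p. zeta k *s p) (at p) (X 3 p)"
    using assms transition_zeta unfolding tangent_section_def by blast
  ultimately show ?thesis
    by (simp add: power_int_add)
qed

theorem proposition3p9:
  fixes k :: nat and d :: int and X :: "3 \<Rightarrow> complex ^ 2 \<Rightarrow> complex ^ 2"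
  assumes "k > 1"
    and "foliation k d X"
    and "only_isolated_singularities X"
    and "\<not> int k dvd d\<^sup>2"
  shows "Sing k = {e2 k} \<and> singular_at k X (e2 k)"
proof
  show "Sing k = {e2 k}"
    using assms(1) by (rule Sing_eq)
  have "\<not> int k dvd d"
    using assms(4) by (auto simp: power2_eq_square)
  hence "zeta k powi d \<noteq> 1"
    using assms(1) by (simp add: zeta_powi_eq_1_iff)
  \<comment> \<open>The origin is fixed by the scaling, so both sides involve the same vector; the
    twist \<open>d - 1\<close> yields the exponent \<open>d\<close>.\<close>
  moreover have "X 3 0 = zeta k powi d *s X 3 0"
    using tangent_section_zeta[of k "d - 1" X 0] assms(1,2) by (simp add: foliation_def)
  ultimately have "X 3 0 = 0"
    by (auto simp: vec_eq_iff)
  \<comment> \<open>The origin of the third slice is the point over \<open>e2 k\<close>, so the zero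
    found there is a singularity at \<open>e2 k\<close>.\<close>
  moreover have "slice 3 0 = vector [0, 0, 1]"
    by (simp add: slice_def)
  hence "chart k 3 0 = e2 k"
    by (simp add: chart_def e2_def)
  ultimately show "singular_at k X (e2 k)"
    using e2_in_wproj by (auto simp: singular_at_def)
qed

end
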